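(* Let $G$ be a graph with $n$ vertices and let $k\geq 1$ be an integer with $n\geq k+1$. Then $\chi(F_k(G))\leq \chi(G)$.
   Context: Graphs are finite, simple and undirected. For a graph $G$ and an integer $k\geq 1$, the $k$-token graph $F_k(G)$ is the graph whose vertices are the $k$-element subsets of $V(G)$, where two vertices $A,B$ are adjacent whenever their symmetric difference $A\triangle B$ is a pair $\{a,b\}$ with $a\in A$, $b\in B$ and $ab\in E(G)$. $\chi$ denotes the chromatic number. *)

theory Defs
  imports "Graph_Theory.Pair_Digraph"
begin

(* Finite simple undirected graphs are rendered by the locale pair_graph: a finite vertex set
   pverts G and a symmetric irreflexive relation parcs G on it, the edge ab being represented by
   the two arcs (a, b) and (b, a). *)

definition proper_coloring :: "'a pair_pre_digraph \<Rightarrow> nat \<Rightarrow> ('a \<Rightarrow> nat) \<Rightarrow> bool" where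
  "proper_coloring G m c \<longleftrightarrow>
     (\<forall>v \<in> pverts G. c v < m) \<and> (\<forall>u v. (u, v) \<in> parcs G \<longrightarrow> c u \<noteq> c v)"

definition chromatic_number :: "'a pair_pre_digraph \<Rightarrow> nat" where
  "chromatic_number G = (LEAST m. \<exists>c. proper_coloring G m c)"

definition token_graph :: "nat \<Rightarrow> 'a pair_pre_digraph \<Rightarrow> 'a set pair_pre_digraph" where
  "token_graph k G =
     (let V = {A. A \<subseteq> pverts G \<and> card A = k}
      in \<lparr> pverts = V,
           parcs = {(A, B). A \<in> V \<and> B \<in> V \<and>
             (\<exists>a b. a \<in> A \<and> b \<in> B \<and> sym_diff A B = {a, b} \<and> (a, b) \<in> parcs G)} \<rparr>)"

lemma token_graph_pair_graph:
  assumes "pair_graph G"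
  shows "pair_graph (token_graph k G)"
proof -
  interpret G: pair_graph G by (rule assms)
  have fin: "finite {A. A \<subseteq> pverts G \<and> card A = k}"
    by (rule finite_subset[of _ "Pow (pverts G)"]) (auto simp: G.pair_finite_verts)
  have V: "parcs (token_graph k G) \<subseteq> pverts (token_graph k G) \<times> pverts (token_graph k G)"
    by (auto simp: token_graph_def)
  then have fin': "finite (parcs (token_graph k G))"
    by (rule finite_subset) (simp add: token_graph_def fin)
  have finV: "finite (pverts (token_graph k G))"
    by (simp add: token_graph_def fin)
  have "sym (parcs G)"
    using G.pair_sym_arcs by (simp add: symmetric_def)
  then have "(B, A) \<in> parcs (token_graph k G)" if AB: "(A, B) \<in> parcs (token_graph k G)" for A B
  proof -
    from AB obtain a b where ab: "a \<in> A" "b \<in> B" "sym_diff A B = {a, b}" "(a, b) \<in> parcs G"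
      unfolding token_graph_def Let_def by auto
    have "(b, a) \<in> parcs G"
      using \<open>sym (parcs G)\<close> ab(4) by (rule symD)
    moreover have "sym_diff B A = {b, a}"
      using ab(3) by (metis Un_commute insert_commute)
    ultimately have "\<exists>b a. b \<in> B \<and> a \<in> A \<and> sym_diff B A = {b, a} \<and> (b, a) \<in> parcs G"
      using ab(1,2) by blast
    with AB show ?thesis
      unfolding token_graph_def Let_def by simp
  qed
  then have "sym (parcs (token_graph k G))"
    by (rule symI)
  moreover have "A \<noteq> B" if "(A, B) \<in> parcs (token_graph k G)" for A B
    using that by (auto simp: token_graph_def)
  ultimately show ?thesis
    using finV fin'
    unfolding pair_graph_def pair_digraph_def pair_pseudo_graph_def pair_fin_digraph_def
      pair_fin_digraph_axioms_def pair_sym_digraph_def pair_sym_digraph_axioms_def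
      pair_loopfree_digraph_def pair_loopfree_digraph_axioms_def pair_wf_digraph_def symmetric_def
    using V by auto
qed

lemma chromatic_number_attained:
  assumes "pair_graph G"
  shows "\<exists>c. proper_coloring G (chromatic_number G) c"
proof -
  interpret G: pair_graph G by (rule assms)
  obtain c :: "'a \<Rightarrow> nat" and m where c: "c ` pverts G = {i. i < m}" "inj_on c (pverts G)"
    using finite_imp_inj_to_nat_seg[OF G.pair_finite_verts] by blast
  have "proper_coloring G m c"
    unfolding proper_coloring_def
  proof (intro conjI ballI allI impI)
    show "c v < m" if "v \<in> pverts G" for v
      using c(1) that by blast
    show "c u \<noteq> c v" if "(u, v) \<in> parcs G" for u v
      using inj_on_eq_iff[OF c(2) G.in_arcsD1[OF that] G.in_arcsD2[OF that]]
        G.pair_no_loops[OF that] by simp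
  qed
  then have "\<exists>c. proper_coloring G m c"
    by blast
  then show ?thesis
    unfolding chromatic_number_def by (rule LeastI[of "\<lambda>m. \<exists>c. proper_coloring G m c"])
qed

end

(* If c is a proper colouring of G with m colours, then colouring a token configuration A by the
   sum of c over A modulo m is proper: moving a token along an edge ab changes the sum by
   c b - c a, which is not divisible by m. *)

theory Submission
  imports Defs "HOL-Number_Theory.Cong"
begin

text \<open>Since \<open>a\<close> lies in \<open>A\<close> and in the symmetric difference, it is
  outside \<open>B\<close>; likewise \<open>b\<close> is outside \<open>A\<close>. Each end of an
  arc is thus the common part plus one fresh vertex, the form in which \<open>sum.insert\<close>
  applies.\<close>

lemma token_graph_arcE:
  assumes "pair_graph G" and "(A, B) \<in> parcs (token_graph k G)"
  obtains a b where "(a, b) \<in> parcs G" "a \<notin> A \<inter> B" "b \<notin> A \<inter> B"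
    "A = insert a (A \<inter> B)" "B = insert b (A \<inter> B)" "finite (A \<inter> B)"
proof -
  interpret G: pair_graph G by (rule assms(1))
  from assms(2) obtain a b where ab: "a \<in> A" "b \<in> B" "sym_diff A B = {a, b}" "(a, b) \<in> parcs G"
    and "A \<subseteq> pverts G"
    unfolding token_graph_def Let_def by auto
  then have "finite (A \<inter> B)"
    using G.pair_finite_verts by (meson finite_Int finite_subset)
  moreover have "a \<notin> B" "b \<notin> A"
    using ab(1-3) by blast+
  moreover from this have "A = insert a (A \<inter> B)" "B = insert b (A \<inter> B)"
    using ab(1-3) by blast+
  ultimately show thesis
    using that ab(4) by blast
qed

lemma proper_coloring_token_graph:
  assumes "pair_graph G" and c: "proper_coloring G m c" and "m > 0"
  shows "proper_coloring (token_graph k G) m (\<lambda>A. (\<Sum>v\<in>A. c v) mod m)"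
proof -
  interpret G: pair_graph G by (rule assms(1))
  have "(\<Sum>v\<in>A. c v) mod m \<noteq> (\<Sum>v\<in>B. c v) mod m"
    if arc: "(A, B) \<in> parcs (token_graph k G)" for A B
  proof
    assume eq: "(\<Sum>v\<in>A. c v) mod m = (\<Sum>v\<in>B. c v) mod m"
    from token_graph_arcE[OF assms(1) arc] obtain a b where ab: "(a, b) \<in> parcs G"
      and notin: "a \<notin> A \<inter> B" "b \<notin> A \<inter> B"
      and AB: "A = insert a (A \<inter> B)" "B = insert b (A \<inter> B)" and fin: "finite (A \<inter> B)" .
    define s where "s = (\<Sum>v\<in>A \<inter> B. c v)"
    have "(\<Sum>v\<in>A. c v) = c a + s" "(\<Sum>v\<in>B. c v) = c b + s"
      using AB notin fin unfolding s_def by (metis sum.insert)+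
    with eq have "[c a + s = c b + s] (mod m)"
      by (simp add: cong_def)
    then have "[c a = c b] (mod m)"
      by (simp add: cong_add_rcancel_nat)
    \<comment> \<open>Colours below \<open>m\<close> are their own residues, so the congruence
      becomes an equality, impossible along an arc.\<close>
    moreover have "c a < m" "c b < m"
      using c G.in_arcsD1[OF ab] G.in_arcsD2[OF ab] by (auto simp: proper_coloring_def)
    ultimately have "c a = c b"
      by (simp add: cong_def)
    with c ab show False
      by (auto simp: proper_coloring_def)
  qed
  \<comment> \<open>Positivity gives the range condition: residues lie below \<open>m\<close>,
    whereas \<open>x mod 0 = x\<close>.\<close>
  with \<open>m > 0\<close> show ?thesis
    by (simp add: proper_coloring_def)
qed

theorem theorem11:
  fixes G :: "'a pair_pre_digraph" and n k :: nat
  assumes "pair_graph G"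
    and "card (pverts G) = n"
    and "k \<ge> 1"
    and "n \<ge> k + 1"
  shows "chromatic_number (token_graph k G) \<le> chromatic_number G"
proof -
  obtain c where c: "proper_coloring G (chromatic_number G) c"
    using chromatic_number_attained[OF assms(1)] by blast
  \<comment> \<open>A vertex exists because \<open>n\<close> is at least \<open>k + 1\<close>; its
    colour lies below \<open>chromatic_number G\<close>, which makes this modulus positive.\<close>
  obtain v where "v \<in> pverts G"
    using assms(2,4) by fastforce
  with c have "chromatic_number G > 0"
    by (auto simp: proper_coloring_def)
  then have "\<exists>c. proper_coloring (token_graph k G) (chromatic_number G) c"
    using proper_coloring_token_graph[OF assms(1) c] by blast
  then show ?thesis
    \<comment> \<open>Only the left side is unfolded: \<open>chromatic_number G\<close> stays as the
      number of colours to which minimality applies.\<close>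
    unfolding chromatic_number_def[of "token_graph k G"] by (rule Least_le)
qed

end
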